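(* Assume $\mathfrak p = 2^{\aleph_0}$. Then there exists a set $X \subseteq 2^\omega$ which is a $\gamma$-set but is not strongly meager, i.e. there is a null set $G \subseteq 2^\omega$ with $X + G = 2^\omega$.
   Context: $2^\omega$ carries the product topology, the product (Lebesgue/coin-tossing) measure, and the group operation $+$ given by coordinatewise addition mod $2$; $X+G=\{x+g : x\in X, g\in G\}$. A family $\mathcal J$ of subsets of $X$ is an $\omega$-cover of $X$ if for every finite $F \subseteq X$ there is $B \in \mathcal J$ with $F \subseteq B$. A topological space $X$ (here a subset of $2^\omega$ with the subspace topology) is a $\gamma$-set if for every $\omega$-cover $\mathcal J$ of $X$ consisting of open sets there is a sequence $\{D_n : n\in\omega\} \subseteq \mathcal J$ with $X \subseteq \bigcup_m \bigcap_{n>m} D_n$. A set $X\subseteq 2^\omega$ is strongly meager if for every null set $G \subseteq 2^\omega$, $X + G \neq 2^\omega$. $\mathfrak p$ is the pseudointersection number: the least cardinality of a family $\mathcal F$ of infinite subsets of $\omega$ such that every finite subfamily has infinite intersection but there is no infinite $A\subseteq\omega$ with $A\setminus F$ finite for all $F\in\mathcal F$. *)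

theory Defs
  imports "HOL-Probability.Probability"
begin

unbundle cardinal_syntax

text \<open>The Cantor space is the type \<^typ>\<open>nat \<Rightarrow> bool\<close> with its type class topology, which is the
  product of the discrete topologies.\<close>

type_synonym cantor = "nat \<Rightarrow> bool"

text \<open>Addition of bits mod 2 is exclusive or, i.e. disequality of truth values.\<close>

definition cantor_add :: "cantor \<Rightarrow> cantor \<Rightarrow> cantor" where
  "cantor_add x y = (\<lambda>n. x n \<noteq> y n)"

definition cantor_sumset :: "cantor set \<Rightarrow> cantor set \<Rightarrow> cantor set" where
  "cantor_sumset X G = {cantor_add x g |x g. x \<in> X \<and> g \<in> G}"

definition cantor_measure :: "cantor measure" where
  "cantor_measure = PiM UNIV (\<lambda>_. measure_pmf (bernoulli_pmf (1/2)))"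

text \<open>Null sets need not be Borel, hence the completion.\<close>

definition cantor_null :: "cantor set \<Rightarrow> bool" where
  "cantor_null G \<longleftrightarrow> G \<in> null_sets (completion cantor_measure)"

definition strongly_meager :: "cantor set \<Rightarrow> bool" where
  "strongly_meager X \<longleftrightarrow> (\<forall>G. cantor_null G \<longrightarrow> cantor_sumset X G \<noteq> UNIV)"

definition omega_cover :: "'a set \<Rightarrow> 'a set set \<Rightarrow> bool" where
  "omega_cover X J \<longleftrightarrow> J \<subseteq> Pow X \<and> (\<forall>F. finite F \<and> F \<subseteq> X \<longrightarrow> (\<exists>B\<in>J. F \<subseteq> B))"

definition gamma_space :: "'a topology \<Rightarrow> bool" where
  "gamma_space T \<longleftrightarrow>
     (\<forall>J. omega_cover (topspace T) J \<and> (\<forall>U\<in>J. openin T U) \<longrightarrow>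
        (\<exists>D :: nat \<Rightarrow> 'a set. range D \<subseteq> J \<and> topspace T \<subseteq> (\<Union>m. \<Inter>n\<in>{m<..}. D n)))"

definition gamma_set :: "'a::topological_space set \<Rightarrow> bool" where
  "gamma_set X \<longleftrightarrow> gamma_space (top_of_set X)"

definition pseudointersection :: "nat set set \<Rightarrow> nat set \<Rightarrow> bool" where
  "pseudointersection \<F> A \<longleftrightarrow> infinite A \<and> (\<forall>F\<in>\<F>. finite (A - F))"

definition p_family :: "nat set set \<Rightarrow> bool" where
  "p_family \<F> \<longleftrightarrow>
     (\<forall>F\<in>\<F>. infinite F) \<and>
     (\<forall>\<E>. \<E> \<subseteq> \<F> \<and> finite \<E> \<longrightarrow> infinite (\<Inter>\<E>)) \<and>
     (\<nexists>A. pseudointersection \<F> A)"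

text \<open>Cardinals are represented by well-order relations, so the least cardinality is determined
  only up to \<open>=o\<close>. That the choice is well-defined is shown in
  \<open>pseudointersection_number_least\<close> below.\<close>

definition pseudointersection_number :: "nat set rel" where
  "pseudointersection_number =
     (SOME r. (\<exists>\<F>. p_family \<F> \<and> r = |\<F>| ) \<and> (\<forall>\<F>. p_family \<F> \<longrightarrow> r \<le>o |\<F>| ))"

lemma p_family_exists: "\<exists>\<F>. p_family \<F>"
proof -
  define col where "col X n = {m. prod_encode (n, m) \<notin> X}" for X n
  define \<F> where "\<F> = {X. \<exists>k. \<forall>n\<ge>k. finite (col X n)}"
  have inf: "infinite X" if "X \<in> \<F>" for X
  proof
    assume fin: "finite X"
    from that obtain k where k: "finite (col X k)" by (auto simp: \<F>_def)
    have "(\<lambda>m. prod_encode (k, m)) ` (- col X k) \<subseteq> X" by (auto simp: col_def)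
    then have "finite ((\<lambda>m. prod_encode (k, m)) ` (- col X k))" using fin finite_subset by blast
    then have "finite (- col X k)"
      by (rule finite_imageD) (auto simp: inj_on_def)
    then show False using k by simp
  qed
  have int: "\<Inter>\<E> \<in> \<F>" if "finite \<E>" "\<E> \<subseteq> \<F>" for \<E>
    using that
  proof (induction \<E>)
    case empty
    then show ?case by (simp add: \<F>_def col_def)
  next
    case (insert X \<E>)
    then obtain k l where "\<forall>n\<ge>k. finite (col X n)" "\<forall>n\<ge>l. finite (col (\<Inter>\<E>) n)"
      by (auto simp: \<F>_def)
    moreover have "col (\<Inter>(insert X \<E>)) n = col X n \<union> col (\<Inter>\<E>) n" for n
      by (auto simp: col_def)
    ultimately have "\<forall>n\<ge>max k l. finite (col (\<Inter>(insert X \<E>)) n)" by simp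
    then show ?case unfolding \<F>_def by blast
  qed
  have "\<not> pseudointersection \<F> A" for A
  proof
    assume A: "pseudointersection \<F> A"
    have fincol: "finite {m. prod_encode (n, m) \<in> A}" for n
    proof -
      define C where "C = {x. fst (prod_decode x) > n}"
      have "col C i = {}" if "i \<ge> Suc n" for i using that by (auto simp: col_def C_def)
      then have "C \<in> \<F>" by (auto simp: \<F>_def intro!: exI[of _ "Suc n"])
      then have "finite (A - C)" using A by (auto simp: pseudointersection_def)
      moreover have "(\<lambda>m. prod_encode (n, m)) ` {m. prod_encode (n, m) \<in> A} \<subseteq> A - C"
        by (auto simp: C_def)
      ultimately have "finite ((\<lambda>m. prod_encode (n, m)) ` {m. prod_encode (n, m) \<in> A})"
        using finite_subset by blast
      then show ?thesis by (rule finite_imageD) (auto simp: inj_on_def)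
    qed
    have "col (- A) n = {m. prod_encode (n, m) \<in> A}" for n by (auto simp: col_def)
    then have "- A \<in> \<F>" using fincol by (auto simp: \<F>_def)
    then have "finite (A - (- A))" using A unfolding pseudointersection_def by blast
    moreover have "A - (- A) = A" by auto
    ultimately show False using A by (simp add: pseudointersection_def)
  qed
  with inf int have "p_family \<F>" unfolding p_family_def by blast
  then show ?thesis ..
qed

lemma pseudointersection_number_least:
  "(\<exists>\<F>. p_family \<F> \<and> pseudointersection_number = |\<F>| ) \<and>
   (\<forall>\<F>. p_family \<F> \<longrightarrow> pseudointersection_number \<le>o |\<F>| )"
proof -
  define R where "R = card_of ` {\<F>. p_family \<F>}"
  have "R \<noteq> {}" "\<forall>r\<in>R. Card_order r"
    using p_family_exists by (auto simp: R_def card_of_Card_order)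
  then obtain r where "r \<in> R" "\<forall>r'\<in>R. r \<le>o r'" using exists_minim_Card_order by blast
  then have "(\<exists>\<F>. p_family \<F> \<and> r = |\<F>| ) \<and> (\<forall>\<F>. p_family \<F> \<longrightarrow> r \<le>o |\<F>| )"
    by (auto simp: R_def)
  then show ?thesis unfolding pseudointersection_number_def by (rule someI)
qed

end

theory Submission
  imports Defs
begin

text \<open>
  The set is a Galvin-Miller tower, adapted to a partition of \<open>\<omega>\<close> into finite blocks. Enumerate all
  pairs of a point \<open>z\<close> and a set \<open>C\<close> of clopen sets in order type continuum, and build an almost
  decreasing transfinite sequence of infinite sets \<open>A\<close>. The set \<open>X\<close> consists of the points of finite
  support and the points obtained from \<open>z\<close> by erasing everything outside the blocks with index in
  \<open>A\<close>. Such a point agrees with \<open>z\<close> on infinitely many blocks, so \<open>z\<close> lies in \<open>X + G\<close>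
  for the null set \<open>G\<close> of points vanishing on infinitely many blocks. If \<open>C\<close> is an \<open>\<omega>\<close>-cover
  of the points constructed so far, then \<open>A\<close> is chosen so sparse that some sequence in \<open>C\<close>
  converges to those points and to every point supported, up to finitely many coordinates, on the
  blocks of \<open>A\<close>; the latter includes all points constructed later.
\<close>

section \<open>Dyadic blocks and a null set\<close>

text \<open>Length \<open>2 ^ e\<close> makes the probability of vanishing on \<open>block e\<close>
  summable in \<open>e\<close>. Dyadic endpoints also keep the blocks disjoint and ordered, so a
  sparse set of indices leaves long gaps. Coordinate 0 lies in no block.\<close>

definition block :: "nat \<Rightarrow> nat set" where
  "block e = {2 ^ e..<2 ^ Suc e}"

definition blocks :: "nat set \<Rightarrow> nat set" where
  "blocks A = (\<Union>e\<in>A. block e)"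

definition zero_io :: "cantor set" where
  "zero_io = {g. \<exists>\<^sub>\<infinity>e. \<forall>i\<in>block e. \<not> g i}"

text \<open>Borel-Cantelli: vanishing on \<open>block e\<close> has probability
  \<open>(1/2) ^ 2 ^ e\<close>, and \<open>zero_io\<close> is the limsup of these events.\<close>

lemma cantor_null_zero_io: "cantor_null zero_io"
proof -
  define M where "M = (\<lambda>_::nat. measure_pmf (bernoulli_pmf (1/2)))"
  interpret product_prob_space M UNIV
    by standard (auto simp: M_def prob_space_measure_pmf prob_space.emeasure_space_1)
  have cm: "cantor_measure = PiM UNIV M" by (simp add: cantor_measure_def M_def)
  define A where "A e = {x \<in> space (PiM UNIV M). \<forall>i\<in>block e. x i \<in> {False}}" for e
  have sp: "space (PiM UNIV M) = UNIV" by (simp add: space_PiM M_def)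
  have fin: "finite (block e)" for e by (simp add: block_def)
  have [measurable]: "A e \<in> sets (PiM UNIV M)" for e
    unfolding A_def using fin by (intro sets.sets_Collect_finite_All sets_Collect_single) (auto simp: M_def)
  have "emeasure (PiM UNIV M) (A e) = (\<Prod>i\<in>block e. emeasure (M i) {False})" for e
    unfolding A_def using fin by (intro emeasure_PiM_Collect) (auto simp: M_def)
  also have "(\<Prod>i\<in>block e. emeasure (M i) {False}) = ennreal ((1/2) ^ 2 ^ e)" for e
    by (simp add: M_def emeasure_pmf_single block_def ennreal_power[symmetric] divide_ennreal)
  finally have em: "emeasure (PiM UNIV M) (A e) = ennreal ((1/2) ^ 2 ^ e)" for e .
  have "limsup A \<in> null_sets (PiM UNIV M)"
  proof (rule borel_cantelli_limsup1)
    \<comment> \<open>Since \<open>e \<le> 2 ^ e\<close>, a geometric series dominates.\<close>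
    have "norm (measure (PiM UNIV M) (A e)) \<le> (1/2) ^ e" for e
      using power_decreasing[of e "2 ^ e" "1/2::real"]
      by (simp add: measure_def em less_imp_le[OF less_exp])
    then show "summable (\<lambda>e. measure (PiM UNIV M) (A e))"
      by (intro summable_comparison_test'[OF summable_geometric[of "1/2::real"]]) simp_all
  qed (auto simp: em)
  moreover have "limsup A = zero_io"
    by (auto simp: limsup_INF_SUP zero_io_def A_def sp INFM_nat_le)
  ultimately show ?thesis
    by (simp add: cantor_null_def cm null_sets_completionI)
qed

section \<open>Clopen codes\<close>

text \<open>Finite unions of basic clopen sets, coded by a countable type.\<close>

definition clopen_of :: "nat \<times> bool list list \<Rightarrow> cantor set" where
  "clopen_of c = {y. map y [0..<fst c] \<in> set (snd c)}"

text \<open>Each point of \<open>F\<close> has a neighbourhood inside \<open>U\<close> fixed by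
  finitely many coordinates. As \<open>F\<close> is finite, one length \<open>M\<close> serves all
  its points, and their initial segments of length \<open>M\<close> form the code.\<close>

lemma open_contains_clopen_of:
  assumes "open U" "finite F" "F \<subseteq> U"
  obtains c where "F \<subseteq> clopen_of c" "clopen_of c \<subseteq> U"
proof -
  have "\<exists>N. \<forall>y. (\<forall>i<N. y i = x i) \<longrightarrow> y \<in> U" if "x \<in> U" for x
  proof -
    have "openin (product_topology (\<lambda>_. euclidean) UNIV) U"
      using \<open>open U\<close> by (simp add: open_fun_def)
    from product_topology_open_contains_basis[OF this \<open>x \<in> U\<close>]
    obtain V where V: "x \<in> (\<Pi>\<^sub>E i\<in>UNIV. V i)" "finite {i. V i \<noteq> (UNIV::bool set)}" "(\<Pi>\<^sub>E i\<in>UNIV. V i) \<subseteq> U"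
      by auto
    obtain N where N: "\<forall>i\<in>{i. V i \<noteq> (UNIV::bool set)}. i < N"
      using V(2) finite_nat_set_iff_bounded by blast
    have "y \<in> U" if y: "\<forall>i<N. y i = x i" for y
    proof -
      have "y i \<in> V i" for i
        using V(1) N y by (cases "V i = UNIV") (auto simp: PiE_iff)
      then show ?thesis using V(3) by (auto simp: PiE_iff)
    qed
    then show ?thesis by blast
  qed
  then obtain N where N: "\<And>x y. x \<in> F \<Longrightarrow> (\<forall>i<N x. y i = x i) \<Longrightarrow> y \<in> U"
    using \<open>F \<subseteq> U\<close> by (metis subsetD)
  obtain M where M: "\<forall>n\<in>N ` F. n \<le> M"
    using \<open>finite F\<close> finite_nat_set_iff_bounded_le[of "N ` F"] by auto
  obtain T where T: "set T = (\<lambda>x. map x [0..<M]) ` F"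
    using finite_list[of "(\<lambda>x. map x [0..<M]) ` F"] \<open>finite F\<close> by auto
  show ?thesis
  proof
    show "F \<subseteq> clopen_of (M, T)" by (auto simp: clopen_of_def T)
    show "clopen_of (M, T) \<subseteq> U"
    proof
      fix y assume "y \<in> clopen_of (M, T)"
      then obtain x where x: "x \<in> F" "\<forall>i<M. y i = x i"
        by (auto simp: clopen_of_def T map_eq_conv)
      then show "y \<in> U" using N[OF x(1)] M by force
    qed
  qed
qed

section \<open>Pseudointersections of small families\<close>

lemma continuum: "|UNIV :: nat set set| =o ctwo ^c natLeq"
  using card_of_Pow_Func[of "UNIV :: nat set"]
  by (simp add: cexp_def ctwo_def Field_natLeq Field_card_of)

text \<open>Otherwise the family would be a \<open>p_family\<close> smaller than the continuum,
  which by assumption is the least possible size.\<close>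

lemma small_family_pseudointersection:
  fixes \<F> :: "nat set set"
  assumes p: "pseudointersection_number =o ctwo ^c natLeq"
    and small: "|\<F>| <o |UNIV :: nat set set|"
    and sfip: "\<And>\<E>. \<E> \<subseteq> \<F> \<Longrightarrow> finite \<E> \<Longrightarrow> infinite (\<Inter>\<E>)"
  obtains A where "pseudointersection \<F> A"
proof (rule ccontr)
  assume "\<not> thesis"
  then have "\<nexists>A. pseudointersection \<F> A" using that by blast
  moreover have "infinite F" if "F \<in> \<F>" for F using sfip[of "{F}"] that by simp
  ultimately have "p_family \<F>" unfolding p_family_def using sfip by blast
  then have "pseudointersection_number \<le>o |\<F>|" using pseudointersection_number_least by blast
  moreover have "|\<F>| <o pseudointersection_number"
    using small ordIso_transitive[OF continuum ordIso_symmetric[OF p]] ordLess_ordIso_trans by blast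
  ultimately show False using not_ordLeq_ordLess by blast
qed

section \<open>Convergent sequences from covers\<close>

text \<open>Cutting \<open>y\<close> off at \<open>k\<close> gives a point of the assumed kind that
  agrees with \<open>y\<close> on the first \<open>fst c\<close> coordinates, and membership depends
  on these only.\<close>

lemma clopen_of_contains_tail:
  assumes "\<And>s. (\<forall>i\<ge>k. \<not> s i) \<Longrightarrow> s \<in> clopen_of c" "\<forall>i\<in>{k..<fst c}. \<not> y i"
  shows "y \<in> clopen_of c"
proof -
  have "(\<lambda>i. i < k \<and> y i) \<in> clopen_of c" using assms(1) by auto
  moreover have "map (\<lambda>i. i < k \<and> y i) [0..<fst c] = map y [0..<fst c]"
    using assms(2) by (auto simp: map_eq_conv)
  ultimately show ?thesis by (simp only: clopen_of_def mem_Collect_eq)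
qed

definition finite_support :: "cantor set" where
  "finite_support = {x. finite {i. x i}}"

text \<open>Codes come from a countable type, so there are only continuum many candidate covers and
  each can be treated at some stage of the tower.\<close>

definition clopen_cover :: "cantor set \<Rightarrow> (nat \<times> bool list list) set \<Rightarrow> bool" where
  "clopen_cover X C \<longleftrightarrow> (\<forall>F. finite F \<and> F \<subseteq> X \<longrightarrow> (\<exists>c\<in>C. F \<subseteq> clopen_of c))"

lemma finite_initial_support: "finite {s :: cantor. \<forall>i\<ge>k. \<not> s i}"
proof (rule finite_imageD)
  show "inj_on Collect {s :: cantor. \<forall>i\<ge>k. \<not> s i}" by (auto simp: inj_on_def)
  have "Collect ` {s :: cantor. \<forall>i\<ge>k. \<not> s i} \<subseteq> Pow {..<k}"
    by (auto simp: not_le[symmetric])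
  then show "finite (Collect ` {s :: cantor. \<forall>i\<ge>k. \<not> s i})"
    using finite_subset by blast
qed

text \<open>A point vanishing on \<open>[k, N)\<close> lies in the clopen set coded by \<open>c = (N, T)\<close> whenever \<open>(k, c)\<close>
  is a member.\<close>

definition tail_codes :: "(nat \<times> bool list list) set \<Rightarrow> nat \<Rightarrow> (nat \<times> nat \<times> bool list list) set" where
  "tail_codes C l = {(k, c) |k c. l \<le> k \<and> c \<in> C \<and> {s. \<forall>i\<ge>k. \<not> s i} \<subseteq> clopen_of c}"

text \<open>The sets of suitable pairs have the strong finite intersection property because a cover
  captures a finite part of \<open>Y\<close> together with all points supported below
  \<open>k\<close>, for every \<open>k\<close>.\<close>

lemma tail_codes_pseudointersection:
  assumes p: "pseudointersection_number =o ctwo ^c natLeq"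
    and small: "|Y| <o |UNIV :: nat set set|"
    and cover: "clopen_cover (finite_support \<union> Y) C"
  obtains S where "infinite S" "\<And>l. finite (S - tail_codes C l)"
    "\<And>x. x \<in> Y \<Longrightarrow> finite {t \<in> S. x \<notin> clopen_of (snd t)}"
proof -
  \<comment> \<open>\<open>G x\<close> forces almost all chosen clopen sets to contain
    \<open>x\<close>; \<open>H l\<close> drives the thresholds to infinity. Pairs are coded as
    numbers to obtain subsets of \<open>nat\<close>.\<close>
  define G where "G x = to_nat ` {t \<in> tail_codes C 0. x \<in> clopen_of (snd t)}" for x
  define H where "H l = to_nat ` tail_codes C l" for l
  have "|range H| \<le>o |UNIV :: nat set|" by (rule card_of_image)
  also have "|UNIV :: nat set| <o |UNIV :: nat set set|"
    using card_of_Pow[of "UNIV :: nat set"] by simp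
  finally have "|range H| <o |UNIV :: nat set set|" .
  moreover have "|G ` Y| <o |UNIV :: nat set set|"
    using card_of_image small ordLeq_ordLess_trans by blast
  ultimately have small': "|G ` Y \<union> range H| <o |UNIV :: nat set set|"
    by (intro card_of_Un_ordLess_infinite) (simp_all add: finite_Pow_iff flip: Pow_UNIV)
  have sfip: "infinite (\<Inter>\<E>)" if \<E>: "\<E> \<subseteq> G ` Y \<union> range H" "finite \<E>" for \<E>
  proof -
    obtain F where F: "finite F" "F \<subseteq> Y" "\<E> \<inter> G ` Y = G ` F"
      using finite_subset_image[of "\<E> \<inter> G ` Y" G Y] \<E>(2) by auto
    obtain L where L: "finite L" "\<E> \<inter> range H = H ` L"
      using finite_subset_image[of "\<E> \<inter> range H" H UNIV] \<E>(2) by auto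
    have "\<exists>c. (k, c) \<in> tail_codes C k \<and> F \<subseteq> clopen_of c" for k
    proof -
      have "{s. \<forall>i\<ge>k. \<not> s i} \<subseteq> finite_support"
      proof
        fix s :: cantor assume "s \<in> {s. \<forall>i\<ge>k. \<not> s i}"
        then have "{i. s i} \<subseteq> {..<k}" by (auto simp: not_le[symmetric])
        then show "s \<in> finite_support" by (simp add: finite_support_def finite_subset)
      qed
      then have "{s. \<forall>i\<ge>k. \<not> s i} \<union> F \<subseteq> finite_support \<union> Y" using F(2) by blast
      moreover have "finite ({s. \<forall>i\<ge>k. \<not> s i} \<union> F)" using F(1) finite_initial_support by blast
      ultimately have "\<exists>c\<in>C. {s. \<forall>i\<ge>k. \<not> s i} \<union> F \<subseteq> clopen_of c"
        using cover by (simp only: clopen_cover_def)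
      then show ?thesis by (auto simp: tail_codes_def)
    qed
    then obtain c where c: "\<And>k. (k, c k) \<in> tail_codes C k" "\<And>k. F \<subseteq> clopen_of (c k)"
      by metis
    obtain m where m: "\<forall>l\<in>L. l \<le> m" using L(1) finite_nat_set_iff_bounded_le by blast
    have "to_nat (k, c k) \<in> \<Inter>\<E>" if "k \<ge> m" for k
    proof
      fix E assume E: "E \<in> \<E>"
      have "\<E> \<subseteq> G ` F \<union> H ` L"
        using \<E>(1) unfolding F(3)[symmetric] L(2)[symmetric] by blast
      then consider x where "x \<in> F" "E = G x" | l where "l \<in> L" "E = H l"
        using E by blast
      then show "to_nat (k, c k) \<in> E"
      proof cases
        case 1
        have "(k, c k) \<in> tail_codes C 0" using c(1)[of k] by (auto simp: tail_codes_def)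
        then show ?thesis using 1 c(2) unfolding G_def by fastforce
      next
        case 2
        then have "(k, c k) \<in> tail_codes C l" using c(1)[of k] m that by (auto simp: tail_codes_def)
        then show ?thesis using 2 by (simp add: H_def)
      qed
    qed
    then have "(\<lambda>k. to_nat (k, c k)) ` {m..} \<subseteq> \<Inter>\<E>" by auto
    moreover have "infinite ((\<lambda>k. to_nat (k, c k)) ` {m..})"
      by (subst finite_image_iff) (auto simp: inj_on_def infinite_Ici)
    ultimately show ?thesis using finite_subset by blast
  qed
  obtain B where B: "pseudointersection (G ` Y \<union> range H) B"
    using small_family_pseudointersection[OF p small' sfip] by blast
  define S :: "(nat \<times> nat \<times> bool list list) set" where "S = to_nat -` B"
  have fin: "finite (S - T)" if "to_nat ` T \<in> G ` Y \<union> range H" for T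
  proof (rule finite_imageD)
    have "to_nat ` (S - T) \<subseteq> B - to_nat ` T" by (auto simp: S_def)
    moreover have "finite (B - to_nat ` T)" using B that unfolding pseudointersection_def by blast
    ultimately show "finite (to_nat ` (S - T))" using finite_subset by blast
  qed (auto intro: inj_on_subset[OF inj_to_nat])
  show thesis
  proof
    \<comment> \<open>\<open>B\<close> may contain numbers that code no pair, but only finitely
      many, being almost included in \<open>H 0\<close>.\<close>
    have "B \<subseteq> to_nat ` S \<union> (B - H 0)" unfolding S_def H_def by auto
    moreover have "finite (B - H 0)" "infinite B" using B unfolding pseudointersection_def by blast+
    ultimately show "infinite S" by (meson finite_Un finite_imageI finite_subset)
    show "finite (S - tail_codes C l)" for l by (rule fin) (auto simp: H_def)
    show "finite {t \<in> S. x \<notin> clopen_of (snd t)}" if "x \<in> Y" for x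
    proof (rule finite_subset)
      show "finite (S - {t \<in> tail_codes C 0. x \<in> clopen_of (snd t)})"
        by (rule fin) (use that in \<open>auto simp: G_def\<close>)
    qed auto
  qed
qed

text \<open>Pairs \<open>(k n, t n)\<close> from \<open>S\<close> and indices \<open>e n\<close>
  from \<open>B\<close> are chosen in turn, each \<open>e n\<close> so large that its block starts
  past \<open>k n\<close> and the length of \<open>t n\<close>, and the next threshold past the end
  of that block. Then \<open>[k n, fst (t n))\<close> misses all chosen blocks.\<close>

lemma diagonal_step:
  assumes p: "pseudointersection_number =o ctwo ^c natLeq"
    and small: "|Y| <o |UNIV :: nat set set|"
    and cover: "clopen_cover (finite_support \<union> Y) C"
    and "infinite B"
  obtains A t where "infinite A" "A \<subseteq> B" "range t \<subseteq> C"
    "\<And>x. x \<in> Y \<Longrightarrow> \<forall>\<^sub>F n in sequentially. x \<in> clopen_of (t n)"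
    "\<And>y. finite ({i. y i} - blocks A) \<Longrightarrow> \<forall>\<^sub>F n in sequentially. y \<in> clopen_of (t n)"
proof -
  obtain S where S: "infinite S" "\<And>l. finite (S - tail_codes C l)"
    "\<And>x. x \<in> Y \<Longrightarrow> finite {t \<in> S. x \<notin> clopen_of (snd t)}"
    using tail_codes_pseudointersection[OF p small cover] by blast
  \<comment> \<open>Only finitely many members of \<open>S\<close> have thresholds below
    \<open>l\<close>, and \<open>B\<close> is unbounded, so both choices can be made as large as
    needed.\<close>
  have pick: "\<exists>u e. u \<in> S \<and> u \<in> tail_codes C l \<and> e \<in> B \<and> fst u \<le> 2 ^ e \<and> fst (snd u) \<le> 2 ^ e" for l
  proof -
    have "infinite (S \<inter> tail_codes C l)" using S(1) S(2)[of l]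
      by (metis Diff_Diff_Int Diff_infinite_finite)
    then obtain u where u: "u \<in> S" "u \<in> tail_codes C l" by (metis IntE all_not_in_conv finite.emptyI)
    obtain e where e: "e \<in> B" "fst u + fst (snd u) \<le> e"
      using \<open>infinite B\<close> unfolding infinite_nat_iff_unbounded_le by blast
    have "e \<le> 2 ^ e" by (simp add: less_imp_le)
    then have "fst u \<le> 2 ^ e" "fst (snd u) \<le> 2 ^ e" using e(2) by linarith+
    then show ?thesis using u e(1) by blast
  qed
  define P where "P z \<longleftrightarrow> fst z \<in> S \<and> fst z \<in> tail_codes C 0 \<and> snd z \<in> B \<and>
     fst (fst z) \<le> 2 ^ snd z \<and> fst (snd (fst z)) \<le> 2 ^ snd z" for z :: "(nat \<times> nat \<times> bool list list) \<times> nat"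
  have "\<exists>f. \<forall>n. P (f n) \<and> 2 ^ Suc (snd (f n)) \<le> fst (fst (f (Suc n)))"
  proof (rule dependent_nat_choice[of "\<lambda>_. P" "\<lambda>_ z z'. 2 ^ Suc (snd z) \<le> fst (fst z')"])
    show "\<exists>z. P z" using pick[of 0] by (auto simp: P_def)
    show "\<exists>z'. P z' \<and> 2 ^ Suc (snd z) \<le> fst (fst z')" for z
      using pick[of "2 ^ Suc (snd z)"] unfolding P_def tail_codes_def by fastforce
  qed
  then obtain f where f: "\<And>n. P (f n)" "\<And>n. 2 ^ Suc (snd (f n)) \<le> fst (fst (f (Suc n)))"
    by blast
  define u where "u n = fst (f n)" for n
  define k where "k n = fst (u n)" for n
  define t where "t n = snd (u n)" for n
  define e where "e n = snd (f n)" for n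
  have f': "u n \<in> S" "u n \<in> tail_codes C 0" "e n \<in> B" "k n \<le> 2 ^ e n" "fst (t n) \<le> 2 ^ e n"
    "2 ^ Suc (e n) \<le> k (Suc n)" for n
    using f(1)[of n] f(2)[of n] by (simp_all add: P_def u_def k_def t_def e_def)
  have "e n < e (Suc n)" for n
  proof -
    have "(2::nat) ^ Suc (e n) \<le> 2 ^ e (Suc n)" using f'(6)[of n] f'(4)[of "Suc n"] by linarith
    then have "Suc (e n) \<le> e (Suc n)" by (rule power_le_imp_le_exp[rotated]) simp
    then show ?thesis by simp
  qed
  then have e: "strict_mono e" by (simp add: strict_mono_Suc_iff)
  have "k n < k (Suc n)" for n
  proof -
    have "(2::nat) ^ e n < 2 ^ Suc (e n)" by simp
    then show ?thesis using f'(4)[of n] f'(6)[of n] by linarith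
  qed
  then have k: "strict_mono k" by (simp add: strict_mono_Suc_iff)
  have u: "inj u"
    using strict_mono_imp_inj_on[OF k] unfolding k_def inj_on_def by metis
  \<comment> \<open>Blocks \<open>e n\<close> with \<open>m \<le> n\<close> start past the length of
    \<open>t m\<close>; those with \<open>n < m\<close> end by \<open>k m\<close>.\<close>
  have off: "i \<notin> blocks (range e)" if i: "k m \<le> i" "i < fst (t m)" for m i
  proof
    assume "i \<in> blocks (range e)"
    then obtain n where n: "2 ^ e n \<le> i" "i < 2 ^ Suc (e n)" by (auto simp: blocks_def block_def)
    show False
    proof (cases "m \<le> n")
      case True
      then have "(2::nat) ^ e m \<le> 2 ^ e n" using e by (simp add: strict_mono_less_eq)
      then show False using f'(5)[of m] n i by linarith
    next
      case False
      then have "k (Suc n) \<le> k m" using k by (simp add: strict_mono_less_eq)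
      then show False using f'(6)[of n] n i by linarith
    qed
  qed
  show thesis
  proof
    show "infinite (range e)" using e by (simp add: range_inj_infinite strict_mono_imp_inj_on)
    show "range e \<subseteq> B" using f' by auto
    have "t n \<in> C" for n using f'(2)[of n] by (auto simp: tail_codes_def t_def)
    then show "range t \<subseteq> C" by blast
  next
    fix x assume "x \<in> Y"
    \<comment> \<open>As \<open>u\<close> is injective, finitely many exceptions in \<open>S\<close>
      come from finitely many indices \<open>n\<close>.\<close>
    have "finite (u -` {t \<in> S. x \<notin> clopen_of (snd t)})"
      using S(3)[OF \<open>x \<in> Y\<close>] u by (rule finite_vimageI)
    then have "finite {n. x \<notin> clopen_of (t n)}"
      by (rule rev_finite_subset) (use f'(1) in \<open>auto simp: t_def\<close>)
    then show "\<forall>\<^sub>F n in sequentially. x \<in> clopen_of (t n)"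
      by (simp add: eventually_cofinite flip: cofinite_eq_sequentially)
  next
    fix y assume "finite ({i. y i} - blocks (range e))"
    then obtain M where M: "\<forall>i\<in>{i. y i} - blocks (range e). i < M"
      using finite_nat_set_iff_bounded by blast
    have "y \<in> clopen_of (t n)" if "n \<ge> M" for n
    proof (rule clopen_of_contains_tail)
      show "s \<in> clopen_of (t n)" if "\<forall>i\<ge>k n. \<not> s i" for s
        using f'(2)[of n] that by (force simp: tail_codes_def k_def t_def)
      show "\<forall>i\<in>{k n..<fst (t n)}. \<not> y i"
      proof
        \<comment> \<open>\<open>M \<le> n \<le> k n\<close> because \<open>k\<close> is strictly
          increasing, so the stray support of \<open>y\<close> ends before
          \<open>k n\<close>.\<close>
        fix i assume i: "i \<in> {k n..<fst (t n)}"
        then have "M \<le> i" using that strict_mono_imp_increasing[OF k, of n] by auto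
        moreover have "i \<notin> blocks (range e)" using off[of n i] i by simp
        ultimately show "\<not> y i" using M by (auto simp: not_less[symmetric])
      qed
    qed
    then show "\<forall>\<^sub>F n in sequentially. y \<in> clopen_of (t n)"
      by (auto simp: eventually_sequentially)
  qed
qed

section \<open>The almost decreasing tower\<close>

text \<open>A subset of \<open>\<omega>\<close> codes a point by its even members and a set of clopen codes by its odd
  members, so both are enumerated by the well-order \<open>|UNIV :: nat set set|\<close>.\<close>

definition index_point :: "nat set \<Rightarrow> cantor" where
  "index_point a = (\<lambda>n. 2 * n \<in> a)"

definition index_cover :: "nat set \<Rightarrow> (nat \<times> bool list list) set" where
  "index_cover a = {c. 2 * to_nat c + 1 \<in> a}"

lemma index_surj: obtains a where "index_point a = z" "index_cover a = C"
proof
  define a where "a = {n. if even n then z (n div 2) else n div 2 \<in> to_nat ` C}"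
  show "index_point a = z" by (simp add: index_point_def a_def)
  show "index_cover a = C" by (auto simp: index_cover_def a_def)
qed

definition restricted_point :: "nat set \<Rightarrow> nat set \<Rightarrow> cantor" where
  "restricted_point a A = (\<lambda>i. index_point a i \<and> i \<in> blocks A)"

text \<open>Only values of \<open>f\<close> below \<open>a\<close> occur, as choice along a
  well-founded relation requires. The clause on \<open>y\<close> anticipates later points, which
  live on blocks of almost subsets of \<open>A\<close>.\<close>

definition tower_step :: "nat set rel \<Rightarrow> (nat set \<Rightarrow> nat set) \<Rightarrow> nat set \<Rightarrow> nat set \<Rightarrow> bool" where
  "tower_step r f a A \<longleftrightarrow> infinite A \<and> (\<forall>b\<in>underS r a. finite (A - f b)) \<and>
     (let Y = (\<lambda>b. restricted_point b (f b)) ` underS r a; C = index_cover a in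
      clopen_cover (finite_support \<union> Y) C \<longrightarrow>
      (\<exists>t. range t \<subseteq> C \<and> (\<forall>x\<in>Y. \<forall>\<^sub>F n in sequentially. x \<in> clopen_of (t n)) \<and>
        (\<forall>y. finite ({i. y i} - blocks A) \<longrightarrow> (\<forall>\<^sub>F n in sequentially. y \<in> clopen_of (t n)))))"

text \<open>Almost inclusion is transitive, so in the induction either the old least set stays least
  or the new one takes its place.\<close>

lemma finite_almost_least:
  assumes "finite K" "K \<noteq> {}" "\<And>b c. b \<in> K \<Longrightarrow> c \<in> K \<Longrightarrow> finite (f b - f c) \<or> finite (f c - f b)"
  shows "\<exists>b\<in>K. \<forall>c\<in>K. finite (f b - f c)"
  using assms
proof (induction K rule: finite_ne_induct)
  case (insert a K)
  then obtain b where b: "b \<in> K" "\<forall>c\<in>K. finite (f b - f c)" by blast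
  show ?case
  proof (cases "finite (f b - f a)")
    case True
    then show ?thesis using b by blast
  next
    case False
    then have ab: "finite (f a - f b)" using insert.prems b(1) by blast
    have "finite (f a - f c)" if "c \<in> K" for c
    proof (rule finite_subset)
      show "f a - f c \<subseteq> (f a - f b) \<union> (f b - f c)" by blast
    qed (use ab b(2) that in blast)
    then show ?thesis by auto
  qed
qed simp

lemma underS_total:
  assumes "Well_order r" "b \<in> Field r" "c \<in> Field r"
  shows "b = c \<or> b \<in> underS r c \<or> c \<in> underS r b"
  using assms unfolding order_on_defs total_on_def underS_def by blast

text \<open>Every stage has fewer than continuum many predecessors, so the assumption on the
  pseudointersection number first gives a set \<open>B\<close> almost below all earlier ones, and
  then lets \<open>diagonal_step\<close> thin it out when the cover at hand requires it.\<close>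

lemma tower_exists:
  assumes p: "pseudointersection_number =o ctwo ^c natLeq"
  obtains f where "\<And>a. tower_step |UNIV :: nat set set| f a (f a)"
proof -
  define r where "r = |UNIV :: nat set set|"
  have co: "Card_order r" and wo: "Well_order r" and field: "Field r = UNIV"
    unfolding r_def by (rule card_of_Card_order, rule card_of_Well_order, rule Field_card_of)
  have under: "b \<in> underS r a \<longleftrightarrow> (b, a) \<in> r - Id" for a b by (auto simp: underS_def)
  have total: "b = c \<or> b \<in> underS r c \<or> c \<in> underS r b" for b c
    using underS_total[OF wo] field by blast
  have "\<exists>f. \<forall>a. tower_step r f a (f a)"
  proof (rule dependent_wf_choice)
    show "wf (r - Id)" using wo by (simp add: well_order_on_def)
  next
    fix f g :: "nat set \<Rightarrow> nat set" and a A
    assume "\<And>b. (b, a) \<in> r - Id \<Longrightarrow> f b = g b"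
    then have eq: "f b = g b" if "b \<in> underS r a" for b using that under by blast
    then have "(\<lambda>b. restricted_point b (f b)) ` underS r a = (\<lambda>b. restricted_point b (g b)) ` underS r a"
      by (intro image_cong) simp_all
    moreover have "(\<forall>b\<in>underS r a. finite (A - f b)) \<longleftrightarrow> (\<forall>b\<in>underS r a. finite (A - g b))"
      using eq by simp
    ultimately show "tower_step r f a A = tower_step r g a A" by (simp only: tower_step_def)
  next
    fix a :: "nat set" and f :: "nat set \<Rightarrow> nat set"
    assume "\<And>b. (b, a) \<in> r - Id \<Longrightarrow> tower_step r f b (f b)"
    then have f: "infinite (f b)" "\<And>c. c \<in> underS r b \<Longrightarrow> finite (f b - f c)" if "b \<in> underS r a" for b
      using that by (auto simp only: under tower_step_def)
    define Y where "Y = (\<lambda>b. restricted_point b (f b)) ` underS r a"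
    have small: "|h ` underS r a| <o |UNIV :: nat set set|" for h :: "nat set \<Rightarrow> 'c"
    proof (rule ordLeq_ordLess_trans[OF card_of_image])
      show "|underS r a| <o |UNIV :: nat set set|"
        using card_of_underS[OF co, of a] field by (simp add: r_def)
    qed
    \<comment> \<open>Among finitely many earlier sets one is almost least; it is infinite and
      almost contained in the intersection.\<close>
    have "infinite (\<Inter>\<E>)" if \<E>: "\<E> \<subseteq> f ` underS r a" "finite \<E>" for \<E>
    proof (cases "\<E> = {}")
      case False
      obtain K where K: "finite K" "K \<subseteq> underS r a" "\<E> = f ` K"
        using finite_subset_image[OF \<E>(2,1)] by auto
      have "finite (f b - f c) \<or> finite (f c - f b)" if "b \<in> K" "c \<in> K" for b c
        using total[of b c] f(2)[of b c] f(2)[of c b] K(2) that by auto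
      then obtain b where b: "b \<in> K" "\<forall>c\<in>K. finite (f b - f c)"
        using finite_almost_least[of K f] K False by blast
      have "f b \<subseteq> \<Inter>\<E> \<union> (\<Union>c\<in>K. f b - f c)" by (auto simp: K(3))
      moreover have "finite (\<Union>c\<in>K. f b - f c)" using K(1) b(2) by blast
      ultimately show ?thesis using f(1) b(1) K(2) by (meson finite_Un finite_subset subsetD)
    qed simp
    then obtain B where "pseudointersection (f ` underS r a) B"
      using small_family_pseudointersection[OF p small] by blast
    then have B: "infinite B" "\<And>b. b \<in> underS r a \<Longrightarrow> finite (B - f b)"
      by (auto simp: pseudointersection_def)
    show "\<exists>A. tower_step r f a A"
    proof (cases "clopen_cover (finite_support \<union> Y) (index_cover a)")
      case True
      obtain A t where A: "infinite A" "A \<subseteq> B" "range t \<subseteq> index_cover a"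
        "\<And>x. x \<in> Y \<Longrightarrow> \<forall>\<^sub>F n in sequentially. x \<in> clopen_of (t n)"
        "\<And>y. finite ({i. y i} - blocks A) \<Longrightarrow> \<forall>\<^sub>F n in sequentially. y \<in> clopen_of (t n)"
        using diagonal_step[OF p small True[unfolded Y_def] B(1)] unfolding Y_def by blast
      have "finite (A - f b)" if "b \<in> underS r a" for b
        using B(2)[OF that] A(2) by (meson Diff_mono finite_subset order_refl)
      then have "tower_step r f a A"
        unfolding tower_step_def Let_def Y_def[symmetric] using A by blast
      then show ?thesis ..
    next
      case False
      then have "tower_step r f a B"
        unfolding tower_step_def Let_def Y_def[symmetric] using B by blast
      then show ?thesis ..
    qed
  qed
  then show thesis using that unfolding r_def by blast
qed

section \<open>The gamma property and the failure of strong meagerness\<close>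

text \<open>The clopen sets whose trace on \<open>X\<close> lies in a member of an open cover again
  capture all finite subsets of \<open>X\<close>, and a convergent sequence of them passes to the
  members containing the traces.\<close>

lemma gamma_set_by_clopen_covers:
  assumes "\<And>C. clopen_cover X C \<Longrightarrow>
    \<exists>t. range t \<subseteq> C \<and> (\<forall>x\<in>X. \<forall>\<^sub>F n in sequentially. x \<in> clopen_of (t n))"
  shows "gamma_set X"
  unfolding gamma_set_def gamma_space_def
proof (intro allI impI, elim conjE)
  fix J :: "cantor set set"
  assume cover: "omega_cover (topspace (top_of_set X)) J" and op: "\<forall>U\<in>J. openin (top_of_set X) U"
  define C where "C = {c. \<exists>B\<in>J. clopen_of c \<inter> X \<subseteq> B}"
  have "clopen_cover X C"
    unfolding clopen_cover_def
  proof (intro allI impI, elim conjE)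
    fix F assume F: "finite F" "F \<subseteq> X"
    then obtain B where B: "B \<in> J" "F \<subseteq> B" using cover by (auto simp: omega_cover_def)
    then obtain U where U: "open U" "B = X \<inter> U" using op by (metis openin_open)
    obtain c where c: "F \<subseteq> clopen_of c" "clopen_of c \<subseteq> U"
      using open_contains_clopen_of[OF U(1) F(1)] B U by blast
    then have "clopen_of c \<inter> X \<subseteq> B" using U(2) by blast
    then have "c \<in> C" using B(1) by (auto simp: C_def)
    then show "\<exists>c\<in>C. F \<subseteq> clopen_of c" using c(1) by blast
  qed
  then obtain t where t: "range t \<subseteq> C" "\<forall>x\<in>X. \<forall>\<^sub>F n in sequentially. x \<in> clopen_of (t n)"
    using assms by blast
  have "\<exists>B. B \<in> J \<and> clopen_of (t n) \<inter> X \<subseteq> B" for n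
  proof -
    have "t n \<in> C" using t(1) by blast
    then show ?thesis by (auto simp: C_def)
  qed
  then obtain D where D: "\<And>n. D n \<in> J" "\<And>n. clopen_of (t n) \<inter> X \<subseteq> D n" by metis
  have "x \<in> (\<Union>m. \<Inter>n\<in>{m<..}. D n)" if "x \<in> X" for x
  proof -
    have "\<forall>\<^sub>F n in sequentially. x \<in> clopen_of (t n)" using t(2) that by (rule bspec)
    then obtain m where m: "\<And>n. n \<ge> m \<Longrightarrow> x \<in> clopen_of (t n)"
      by (auto simp: eventually_sequentially)
    have "x \<in> D n" if "n > m" for n using D(2)[of n] m[of n] \<open>x \<in> X\<close> that by auto
    then have "x \<in> (\<Inter>n\<in>{m<..}. D n)" by simp
    then show ?thesis by blast
  qed
  then have "topspace (top_of_set X) \<subseteq> (\<Union>m. \<Inter>n\<in>{m<..}. D n)" by auto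
  moreover have "range D \<subseteq> J" using D(1) by blast
  ultimately show "\<exists>D :: nat \<Rightarrow> cantor set. range D \<subseteq> J \<and> topspace (top_of_set X) \<subseteq> (\<Union>m. \<Inter>n\<in>{m<..}. D n)"
    by blast
qed

theorem theorem2p1:
  assumes "pseudointersection_number =o ctwo ^c natLeq"
  shows "\<exists>X :: (nat \<Rightarrow> bool) set. gamma_set X \<and> \<not> strongly_meager X"
proof -
  define r where "r = |UNIV :: nat set set|"
  obtain f where f: "\<And>a. tower_step r f a (f a)"
    using tower_exists[OF assms] unfolding r_def by blast
  have total: "b = c \<or> b \<in> underS r c \<or> c \<in> underS r b" for b c
    using underS_total[OF card_of_Well_order[of "UNIV :: nat set set"]] by (simp add: r_def Field_card_of)
  define x where "x a = restricted_point a (f a)" for a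
  define X where "X = finite_support \<union> range x"
  have "gamma_set X"
  proof (rule gamma_set_by_clopen_covers)
    fix C assume C: "clopen_cover X C"
    \<comment> \<open>Every family of codes is listed at some stage \<open>a\<close>; points from
      earlier stages belong to \<open>X\<close>, so the cover condition of that stage holds.\<close>
    obtain a where a: "index_cover a = C" using index_surj by blast
    have "finite_support \<union> x ` underS r a \<subseteq> X" by (auto simp: X_def)
    then have "clopen_cover (finite_support \<union> x ` underS r a) C"
      using C unfolding clopen_cover_def by (meson order_trans)
    then obtain t where t: "range t \<subseteq> C"
      "\<And>y. y \<in> x ` underS r a \<Longrightarrow> \<forall>\<^sub>F n in sequentially. y \<in> clopen_of (t n)"
      "\<And>y. finite ({i. y i} - blocks (f a)) \<Longrightarrow> \<forall>\<^sub>F n in sequentially. y \<in> clopen_of (t n)"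
      using f[of a] unfolding tower_step_def Let_def a x_def[symmetric] by blast
    have "\<forall>\<^sub>F n in sequentially. y \<in> clopen_of (t n)" if "y \<in> X" for y
    proof -
      from that consider "y \<in> finite_support" | b where "y = x b" "b \<in> underS r a"
        | b where "y = x b" "b = a \<or> a \<in> underS r b"
        using total[of _ a] by (auto simp: X_def)
      then show ?thesis
      proof cases
        case 1
        then show ?thesis by (intro t(3)) (simp add: finite_support_def)
      next
        case 2
        then show ?thesis by (intro t(2)) simp
      next
        case 3
        \<comment> \<open>The tower is almost decreasing, and since blocks are finite the missing
          indices account for finitely many coordinates only.\<close>
        have "finite (f b - f a)" using 3(2) f[of b] by (auto simp: tower_step_def)
        then have "finite (blocks (f b - f a))" by (auto simp: blocks_def block_def)
        moreover have "{i. y i} - blocks (f a) \<subseteq> blocks (f b - f a)"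
          by (auto simp: 3(1) x_def restricted_point_def blocks_def)
        ultimately show ?thesis by (intro t(3)) (rule finite_subset)
      qed
    qed
    then show "\<exists>t. range t \<subseteq> C \<and> (\<forall>y\<in>X. \<forall>\<^sub>F n in sequentially. y \<in> clopen_of (t n))"
      using t(1) by blast
  qed
  moreover have "z \<in> cantor_sumset X zero_io" for z
  proof -
    obtain a where a: "index_point a = z" using index_surj by blast
    \<comment> \<open>\<open>x a\<close> agrees with \<open>z\<close> on the blocks indexed by
      \<open>f a\<close>, so their sum vanishes there; addition mod 2 being self-inverse,
      \<open>z\<close> is recovered as \<open>x a\<close> plus \<open>g\<close>.\<close>
    define g where "g = cantor_add (x a) z"
    have "\<forall>i\<in>block e. \<not> g i" if "e \<in> f a" for e
      using that by (auto simp: g_def cantor_add_def x_def restricted_point_def blocks_def a)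
    then have "f a \<subseteq> {e. \<forall>i\<in>block e. \<not> g i}" by blast
    moreover have "infinite (f a)" using f[of a] by (simp add: tower_step_def)
    ultimately have "g \<in> zero_io"
      using finite_subset by (auto simp: zero_io_def INFM_iff_infinite)
    moreover have "z = cantor_add (x a) g" by (auto simp: g_def cantor_add_def)
    moreover have "x a \<in> X" by (simp add: X_def)
    ultimately show ?thesis by (auto simp: cantor_sumset_def)
  qed
  then have "\<not> strongly_meager X"
    using cantor_null_zero_io by (auto simp: strongly_meager_def)
  ultimately show ?thesis by blast
qed

end
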